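(* Let $U=(U_y)_{y\in\mathbb{Z}}$ and $V=(V_x)_{x\in\mathbb{Z}}$ be arbitrary (deterministic) sequences in $\{-1,1\}^{\mathbb{Z}}$, and let $\omega$ be the directed graph with vertex set $\mathbb{Z}^2$ and edge set $\{((x,y),(x+U_y,y+V_x)) : (x,y)\in\mathbb{Z}^2\}$. Then the only cycles in $\omega$ are traps; that is, every cycle in $\omega$ has length $2$.
   Context: A cycle in $\omega$ of length $n\ge1$ is a sequence $a_0,\ldots,a_n$ in $\mathbb{Z}^2$ with $a_n=a_0$, $a_0,\ldots,a_{n-1}$ pairwise distinct, and $(a_k,a_{k+1})\in\omega$ for $k=0,\ldots,n-1$. A trap is a cycle in $\omega$ of length $2$. *)

theory Defs
  imports Main
begin

text \<open>
  A directed graph on \<open>\<int>\<^sup>2\<close> is given by its edge relation; the vertex set is the whole type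
  \<^typ>\<open>int \<times> int\<close>.
\<close>

definition corner_graph :: "(int \<Rightarrow> int) \<Rightarrow> (int \<Rightarrow> int) \<Rightarrow> (int \<times> int) rel" where
  "corner_graph U V = {((x, y), (x + U y, y + V x)) | x y. True}"

text \<open>The sequence \<open>a\<^sub>0, \<dots>, a\<^sub>n\<close> is a list with \<open>n + 1\<close> entries.\<close>

definition is_cycle :: "'a rel \<Rightarrow> nat \<Rightarrow> 'a list \<Rightarrow> bool" where
  "is_cycle \<omega> n a \<longleftrightarrow>
     n \<ge> 1 \<and> length a = n + 1 \<and> a ! n = a ! 0 \<and> distinct (take n a) \<and>
     (\<forall>k<n. (a ! k, a ! (k + 1)) \<in> \<omega>)"

definition is_trap :: "'a rel \<Rightarrow> 'a list \<Rightarrow> bool" where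
  "is_trap \<omega> a \<longleftrightarrow> is_cycle \<omega> 2 a"

end

theory Submission
  imports Defs "HOL-Library.Product_Plus"
begin

text \<open>
  Follow a cycle of length \<open>n\<close> and write \<open>(u\<^sub>k, v\<^sub>k)\<close> for the direction of its \<open>k\<close>-th step. Two
  computations of its total turning contradict each other unless \<open>n = 2\<close>.

  \<^emph>\<open>Energy.\<close> A walk in the graph is the explicit Euler scheme for the Hamiltonian system
  \<open>x' = U(y)\<close>, \<open>y' = V(x)\<close>. Take \<open>F\<close> and \<open>G\<close> to be antiderivatives of \<open>U\<close> and \<open>V\<close> by the trapezoid rule.
  Then a step changes the energy \<open>G(x) - F(y)\<close> by exactly \<open>u\<^sub>k v\<^sub>k\<^sub>+\<^sub>1 - v\<^sub>k u\<^sub>k\<^sub>+\<^sub>1\<close>, which is \<open>2\<close> if the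
  walk then turns left, \<open>-2\<close> if it turns right and \<open>0\<close> if it goes straight. Around a cycle the energy
  returns to its initial value, so there are as many left turns as right turns
  (\<open>sum_turns_closed_orbit\<close>).

  \<^emph>\<open>Topology.\<close> If \<open>n \<ge> 3\<close>, the cycle never reverses its direction, since a reversal visits a vertex
  twice within two steps. It is then a simple closed polygon, because the diagonals of one parity
  class form a square lattice, and by the theorem of turning tangents its left and right turns
  differ by four (\<open>turning_number_closed_walk\<close>).

  The theorem of turning tangents is proved by a discrete form of Hopf's secant argument. The secant
  \<open>p\<^sub>j - p\<^sub>i\<close> is nonzero on a triangle of index pairs \<open>i < j\<close>. Its rotation along the boundary of a
  unit cell of the triangle is zero (\<open>swing_commute\<close>), so the rotation along the diagonal side, which
  is the total turning, equals the rotation along the other two sides (\<open>turning_eq_fans\<close>). When the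
  walk starts at a lowest vertex, the secants on these two sides stay in half planes, where the
  rotation depends on the end points only.
\<close>

section \<open>Rotation of lattice vectors, in quarter turns\<close>

definition diagonals :: "(int \<times> int) set" where
  "diagonals = {-1, 1} \<times> {-1, 1}"

text \<open>
  The sectors are quadrants that contain exactly one of their two bounding half-axes, numbered
  counterclockwise. Each sector contains one diagonal, and a diagonal step between nonzero vectors
  never leads to the opposite sector. The origin gets the default value \<open>3\<close>.
\<close>
definition sector :: "int \<times> int \<Rightarrow> int" where
  "sector w =
     (if fst w > 0 \<and> snd w \<ge> 0 then 0
      else if fst w \<le> 0 \<and> snd w > 0 then 1
      else if fst w < 0 \<and> snd w \<le> 0 then 2 else 3)"

text \<open>
  The representative of the sector difference modulo \<open>4\<close> in \<open>{-1, 0, 1, 2}\<close>. It measures a signed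
  rotation as long as the vectors do not lie in opposite sectors, where it takes the value \<open>2\<close>.
\<close>
definition swing :: "int \<times> int \<Rightarrow> int \<times> int \<Rightarrow> int" where
  "swing w w' = (sector w' - sector w + 1) mod 4 - 1"

lemma sector_uminus:
  assumes "w \<noteq> 0"
  shows "sector (- w) = (sector w + 2) mod 4"
  using assms by (cases w) (auto simp: sector_def zero_prod_def)

lemma sector_range: "sector w \<in> {0, 1, 2, 3}"
  by (simp add: sector_def)

lemma swing_uminus:
  assumes "w \<noteq> 0" "w' \<noteq> 0"
  shows "swing (- w) (- w') = swing w w'"
  using sector_range[of w] sector_range[of w']
  unfolding swing_def sector_uminus[OF assms(1)] sector_uminus[OF assms(2)] by auto

lemma diagonals_cases:
  assumes "d \<in> diagonals"
  obtains "d = (1, 1)" | "d = (1, -1)" | "d = (-1, 1)" | "d = (-1, -1)"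
  using assms by (auto simp: diagonals_def)

lemma diagonals_uminus: "d \<in> diagonals \<Longrightarrow> - d \<in> diagonals"
  by (auto simp: diagonals_def elim!: diagonals_cases)

text \<open>
  For two consecutive steps that are not a reversal, the swing is the turn to the left; this
  formula links the topological count to the energy.
\<close>
lemma swing_diagonals:
  assumes "d \<in> diagonals" "d' \<in> diagonals" "d + d' \<noteq> 0"
  shows "2 * swing d d' = fst d * snd d' - snd d * fst d'"
  using assms by (elim diagonals_cases) (simp_all add: swing_def sector_def zero_prod_def)

text \<open>
  Turning from one step to the next can be done in two stages through the secant over both steps.
  These are the triangles along the diagonal side in Hopf's argument.
\<close>
lemma swing_via_sum:
  assumes "d \<in> diagonals" "d' \<in> diagonals" "d + d' \<noteq> 0"
  shows "swing d (d + d') + swing (d + d') d' = swing d d'"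
  using assms by (elim diagonals_cases) (simp_all add: swing_def sector_def zero_prod_def)

text \<open>
  Here \<open>a\<close> and \<open>b\<close> are the vectors from a lowest vertex of a closed walk to its successor and to its
  predecessor. There are two cases, according to the orientation of the walk: the value is \<open>4\<close> for
  \<open>a = (1, 1)\<close> and \<open>-4\<close> for \<open>a = (-1, 1)\<close>.
\<close>
lemma closed_walk_swing:
  assumes "a \<in> diagonals" "b \<in> diagonals" "snd a \<ge> 0" "snd b \<ge> 0" "a \<noteq> b"
  shows "\<bar>2 * (sector b - sector a) + swing b (b - a) + swing (b - a) (- a) + swing (- b) a\<bar> = 4"
  using assms by (elim diagonals_cases) (simp_all add: swing_def sector_def)

text \<open>
  The closed upper half plane without the origin meets only the sectors \<open>0\<close>, \<open>1\<close> and \<open>2\<close>. There the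
  sector number is itself a continuous choice of angle, so swings telescope.
\<close>
lemma swing_upper_half_plane:
  assumes "d \<in> diagonals" "w \<noteq> 0" "w + d \<noteq> 0" "snd w \<ge> 0" "snd (w + d) \<ge> 0"
  shows "swing w (w + d) = sector (w + d) - sector w"
proof -
  obtain x y where w: "w = (x, y)" by fastforce
  have "\<bar>sector (w + d) - sector w\<bar> \<le> 1"
    using assms unfolding w
    by (elim diagonals_cases) (auto simp: sector_def zero_prod_def)
  then have "sector (w + d) - sector w + 1 \<in> {0, 1, 2}" by auto
  then show ?thesis unfolding swing_def by auto
qed

text \<open>
  The secant has no rotation around a cell: the four vectors are the corners of a possibly
  degenerate parallelogram whose sides are diagonals. By the parity condition both they and the
  origin belong to the lattice of points with even coordinate sum. The parallelogram meets this
  lattice in its corners only, so the origin is not in it. Without that condition \<open>w = (1, 0)\<close>, \<open>d = (-1, 1)\<close>, \<open>e = (1, 1)\<close> would go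
  once around the origin.
\<close>
lemma swing_commute:
  assumes "d \<in> diagonals" "e \<in> diagonals" "even (fst w + snd w)"
    and "w \<noteq> 0" "w + d \<noteq> 0" "w - e \<noteq> 0" "w + d - e \<noteq> 0"
  shows "swing w (w + d) + swing (w + d) (w + d - e) = swing w (w - e) + swing (w - e) (w + d - e)"
proof -
  obtain x y where w: "w = (x, y)" by (cases w)
  \<comment> \<open>Each coordinate changes by at most 2, so beyond distance 2 from an axis its sign is constant.\<close>
  have "x < -2 \<or> x = -2 \<or> x = -1 \<or> x = 0 \<or> x = 1 \<or> x = 2 \<or> x > 2" by linarith
  moreover have "y < -2 \<or> y = -2 \<or> y = -1 \<or> y = 0 \<or> y = 1 \<or> y = 2 \<or> y > 2" by linarith
  ultimately show ?thesis
    using assms unfolding w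
    by (elim disjE diagonals_cases) (simp_all add: swing_def sector_def zero_prod_def)
qed

section \<open>The theorem of turning tangents for diagonal lattice walks\<close>

text \<open>
  The fan from \<open>p i\<close> is the rotation of the secants \<open>p k - p i\<close> while their end point \<open>p k\<close> moves along
  the walk. The lemma compares the fans from two adjacent apexes: they bound a strip of the triangle
  of index pairs, and the strip is a union of cells, with a triangle at its start.
\<close>
lemma fan_triangle:
  fixes p :: "nat \<Rightarrow> int \<times> int"
  assumes step: "\<And>k. p (Suc k) - p k \<in> diagonals"
    and "Suc i < j" and inj: "inj_on p {i..j}"
  shows "(\<Sum>k = Suc i..<j. swing (p k - p i) (p (Suc k) - p i)) + swing (p j - p i) (p j - p (Suc i))
       = swing (p (Suc i) - p i) (p (Suc (Suc i)) - p (Suc i))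
         + (\<Sum>k = Suc (Suc i)..<j. swing (p k - p (Suc i)) (p (Suc k) - p (Suc i)))"
proof -
  have parity: "even (fst (p k - p i) + snd (p k - p i))" if "i \<le> k" for k
    using that
  proof (induction k rule: dec_induct)
    case (step k)
    have "even (fst (p (Suc k) - p k) + snd (p (Suc k) - p k))"
      using assms(1)[of k] by (elim diagonals_cases) simp_all
    with step.IH have "even ((fst (p k - p i) + snd (p k - p i))
                             + (fst (p (Suc k) - p k) + snd (p (Suc k) - p k)))"
      by (rule dvd_add)
    then show ?case by (simp add: algebra_simps)
  qed simp
  from \<open>Suc i < j\<close> have "Suc (Suc i) \<le> j" by simp
  then show ?thesis using inj
  proof (induction j rule: dec_induct)
    case base
    have "p (Suc (Suc i)) \<noteq> p i"
      using inj_onD[OF base, of i "Suc (Suc i)"] by auto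
    then have "(p (Suc i) - p i) + (p (Suc (Suc i)) - p (Suc i)) \<noteq> 0"
      by (simp add: algebra_simps)
    from swing_via_sum[OF step step this] show ?case by (simp add: algebra_simps)
  next
    case (step j)
    let ?w = "p j - p i" and ?d = "p (Suc j) - p j" and ?e = "p (Suc i) - p i"
    have ne: "p j \<noteq> p i" "p (Suc j) \<noteq> p i" "p j \<noteq> p (Suc i)" "p (Suc j) \<noteq> p (Suc i)"
      using step.hyps step.prems by (auto dest!: inj_onD)
    have "swing ?w (?w + ?d) + swing (?w + ?d) (?w + ?d - ?e) =
          swing ?w (?w - ?e) + swing (?w - ?e) (?w + ?d - ?e)"
      by (rule swing_commute) (use assms(1) parity[of j] step.hyps ne in \<open>auto simp: algebra_simps\<close>)
    moreover have "inj_on p {i..j}"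
      using step.prems by (rule inj_on_subset) auto
    ultimately show ?case using step.IH step.hyps by (simp add: algebra_simps)
  qed
qed

text \<open>
  Stacking the strips of \<open>fan_triangle\<close> gives Hopf's identity: the total turning of a simple walk is
  the rotation of the secant when first its end point moves from the second vertex to the last one,
  and then its starting point moves from the first vertex to the last but one.
\<close>
lemma turning_eq_fans:
  fixes p :: "nat \<Rightarrow> int \<times> int"
  assumes step: "\<And>k. p (Suc k) - p k \<in> diagonals"
    and "i < j" and "inj_on p {i..j}"
  shows "(\<Sum>k = i..<j - 1. swing (p (Suc k) - p k) (p (Suc (Suc k)) - p (Suc k)))
       = (\<Sum>k = Suc i..<j. swing (p k - p i) (p (Suc k) - p i))
         + (\<Sum>k = i..<j - 1. swing (p j - p k) (p j - p (Suc k)))"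
proof -
  from \<open>i < j\<close> have "i \<le> j - 1" by simp
  then show ?thesis using assms(3)
  proof (induction i rule: inc_induct)
    case base
    show ?case using \<open>i < j\<close> by simp
  next
    case (step i)
    have "Suc i < j" using step.hyps by simp
    moreover have "inj_on p {Suc i..j}"
      using step.prems by (rule inj_on_subset) auto
    ultimately show ?case
      using step.IH fan_triangle[of p i j, OF assms(1) _ step.prems]
      by (simp add: sum.atLeast_Suc_lessThan)
  qed
qed

text \<open>
  Hopf's identity cannot be applied to the whole closed walk, since the secant from its first vertex
  to its last one vanishes. It is applied to the vertices \<open>1, \<dots>, n\<close>, and the strip from \<open>0\<close> to
  \<open>n - 1\<close> is added; the triangle of index pairs then lacks only the corner \<open>(0, n)\<close>. The boundary
  passes this corner through \<open>(0, n - 1)\<close>, \<open>(1, n - 1)\<close> and \<open>(1, n)\<close>.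
\<close>
theorem turning_number_closed_walk:
  fixes p :: "nat \<Rightarrow> int \<times> int"
  assumes step: "\<And>k. p (Suc k) - p k \<in> diagonals"
    and "n \<ge> 3" and periodic: "\<And>k. p (k + n) = p k"
    and inj: "inj_on p {..<n}"
    and lowest: "\<And>k. snd (p 0) \<le> snd (p k)"
  shows "\<bar>\<Sum>k<n. swing (p (Suc k) - p k) (p (Suc (Suc k)) - p (Suc k))\<bar> = 4"
proof -
  let ?\<tau> = "\<lambda>k. swing (p (Suc k) - p k) (p (Suc (Suc k)) - p (Suc k))"
  define m where "m = n - 2"
  have n: "n = Suc (Suc m)" "1 \<le> m" using \<open>n \<ge> 3\<close> by (auto simp: m_def)
  have pn: "p (Suc (Suc m)) = p 0" "p (Suc (Suc (Suc m))) = p 1"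
    using periodic[of 0] periodic[of 1] n by simp_all
  have ne: "p k \<noteq> p l" if "k < n" "l < n" "k \<noteq> l" for k l
    using inj that by (auto dest: inj_onD)
  let ?a = "p 1 - p 0" and ?b = "p (Suc m) - p 0"
  have a: "?a \<in> diagonals" using step[of 0] by simp
  have b: "?b \<in> diagonals"
    using diagonals_uminus[OF step[of "Suc m"]] pn by simp
  \<comment> \<open>All secants from the lowest vertex lie in the closed upper half plane.\<close>
  have upper: "swing (p k - p 0) (p (Suc k) - p 0) = sector (p (Suc k) - p 0) - sector (p k - p 0)"
    if "k \<in> {1..<Suc m}" for k
    using swing_upper_half_plane[OF step[of k], of "p k - p 0"] ne[of k 0] ne[of "Suc k" 0]
      lowest[of k] lowest[of "Suc k"] that n by simp
  have start_fan: "(\<Sum>k = 1..<Suc m. swing (p k - p 0) (p (Suc k) - p 0)) = sector ?b - sector ?a"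
  proof -
    have "(\<Sum>k = 1..<Suc m. swing (p k - p 0) (p (Suc k) - p 0))
        = (\<Sum>k = 1..<Suc m. sector (p (Suc k) - p 0) - sector (p k - p 0))"
      by (intro sum.cong refl upper)
    also have "\<dots> = sector ?b - sector ?a"
      using n by (subst sum_Suc_diff') auto
    finally show ?thesis .
  qed
  \<comment> \<open>The secants to the lowest vertex are the negatives of those from it, so they rotate alike.\<close>
  have end_fan: "(\<Sum>k = 1..<Suc m. swing (p n - p k) (p n - p (Suc k))) = sector ?b - sector ?a"
  proof -
    have "swing (p n - p k) (p n - p (Suc k)) = swing (p k - p 0) (p (Suc k) - p 0)"
      if "k \<in> {1..<Suc m}" for k
      using swing_uminus[of "p k - p 0" "p (Suc k) - p 0"] ne[of k 0] ne[of "Suc k" 0] that n pn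
      by simp
    then show ?thesis unfolding start_fan[symmetric] by (intro sum.cong refl)
  qed
  have "inj_on p {1..n}"
  proof (rule inj_onI)
    fix k l assume kl: "k \<in> {1..n}" "l \<in> {1..n}" "p k = p l"
    show "k = l"
      using kl ne[of k l] ne[of 0 k] ne[of 0 l] pn n by (cases "k = n"; cases "l = n") auto
  qed
  from turning_eq_fans[of p 1 n, OF step _ this]
  have "(\<Sum>k = 1..<Suc m. ?\<tau> k)
      = (\<Sum>k = 2..<n. swing (p k - p 1) (p (Suc k) - p 1)) + (sector ?b - sector ?a)"
    using n end_fan by (simp add: numeral_2_eq_2)
  also have "(\<Sum>k = 2..<n. swing (p k - p 1) (p (Suc k) - p 1))
      = (\<Sum>k = 2..<Suc m. swing (p k - p 1) (p (Suc k) - p 1)) + swing (?b - ?a) (- ?a)"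
    using n pn by simp
  also have "(\<Sum>k = 2..<Suc m. swing (p k - p 1) (p (Suc k) - p 1))
      = (sector ?b - sector ?a) + swing ?b (?b - ?a) - ?\<tau> 0"
  proof -
    have "inj_on p {0..Suc m}" using inj by (rule inj_on_subset) (auto simp: n)
    from fan_triangle[of p 0 "Suc m", OF step _ this] n start_fan show ?thesis
      by (simp add: numeral_2_eq_2)
  qed
  finally have "(\<Sum>k = 1..<Suc m. ?\<tau> k) + ?\<tau> 0 + ?\<tau> (Suc m)
      = 2 * (sector ?b - sector ?a) + swing ?b (?b - ?a) + swing (?b - ?a) (- ?a) + swing (- ?b) ?a"
    using pn by simp
  moreover have "(\<Sum>k<n. ?\<tau> k) = (\<Sum>k = 1..<Suc m. ?\<tau> k) + ?\<tau> 0 + ?\<tau> (Suc m)"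
    by (simp add: n lessThan_atLeast0 sum.atLeast_Suc_lessThan)
  moreover have "?a \<noteq> ?b" using ne[of 1 "Suc m"] n by auto
  then have "\<bar>2 * (sector ?b - sector ?a) + swing ?b (?b - ?a) + swing (?b - ?a) (- ?a) + swing (- ?b) ?a\<bar> = 4"
    using a b lowest[of 1] lowest[of "Suc m"] by (intro closed_walk_swing) auto
  ultimately show ?thesis by simp
qed

section \<open>The energy balance of a closed orbit\<close>

lemma int_antidifference:
  fixes g :: "int \<Rightarrow> int"
  obtains F where "\<And>y. F (y + 1) = F y + g y"
proof
  fix y :: int
  let ?F = "\<lambda>y. (\<Sum>j = 0..<y. g j) - (\<Sum>j = y..<0. g j)"
  show "?F (y + 1) = ?F y + g y"
  proof (cases "y \<ge> 0")
    case True
    then have "{0..<y + 1} = insert y {0..<y}" by auto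
    then show ?thesis using True by simp
  next
    case False
    then have "{y..<0} = insert y {y + 1..<0}" by auto
    then show ?thesis using False by simp
  qed
qed

text \<open>
  Of all the discrete antiderivatives, the one by the trapezoid rule is symmetric in the two ends of
  an edge, so that one formula holds for steps in both directions.
\<close>
lemma trapezoid_potential:
  fixes U :: "int \<Rightarrow> int"
  obtains F where "\<And>y s. s \<in> {-1, 1} \<Longrightarrow> F (y + s) - F y = s * (U y + U (y + s))"
proof -
  obtain F where F: "\<And>y. F (y + 1) = F y + (U y + U (y + 1))"
    using int_antidifference[of "\<lambda>y. U y + U (y + 1)"] by auto
  have "F (y + s) - F y = s * (U y + U (y + s))" if "s \<in> {-1, 1}" for y s
    using that F[of y] F[of "y - 1"] by auto
  then show ?thesis using that by blast
qed

text \<open>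
  With trapezoid potentials \<open>F\<close> of \<open>U\<close> and \<open>G\<close> of \<open>V\<close>, a step changes \<open>F(y)\<close> by
  \<open>v\<^sub>k u\<^sub>k + v\<^sub>k u\<^sub>k\<^sub>+\<^sub>1\<close> and \<open>G(x)\<close> by \<open>u\<^sub>k v\<^sub>k + u\<^sub>k v\<^sub>k\<^sub>+\<^sub>1\<close>. In the difference the products at equal times
  cancel, and what remains is the cross product of consecutive steps.
\<close>
lemma sum_turns_closed_orbit:
  fixes x y :: "nat \<Rightarrow> int"
  assumes U: "\<And>t. U t \<in> {-1, 1}" and V: "\<And>t. V t \<in> {-1, 1}"
    and x: "\<And>k. x (Suc k) = x k + U (y k)" and y: "\<And>k. y (Suc k) = y k + V (x k)"
    and closed: "x n = x 0" "y n = y 0"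
  shows "(\<Sum>k<n. U (y k) * V (x (Suc k)) - V (x k) * U (y (Suc k))) = 0"
proof -
  obtain F where F: "\<And>t s. s \<in> {-1, 1} \<Longrightarrow> F (t + s) - F t = s * (U t + U (t + s))"
    using trapezoid_potential[of U] by blast
  obtain G where G: "\<And>t s. s \<in> {-1, 1} \<Longrightarrow> G (t + s) - G t = s * (V t + V (t + s))"
    using trapezoid_potential[of V] by blast
  define H where "H k = G (x k) - F (y k)" for k
  have "U (y k) * V (x (Suc k)) - V (x k) * U (y (Suc k)) = H (Suc k) - H k" for k
    using F[OF V, of "y k" "x k"] G[OF U, of "x k" "y k"]
    by (simp add: H_def x y algebra_simps)
  then have "(\<Sum>k<n. U (y k) * V (x (Suc k)) - V (x k) * U (y (Suc k))) = H n - H 0"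
    by (simp add: sum_lessThan_telescope)
  then show ?thesis using closed by (simp add: H_def)
qed

section \<open>Cycles are traps\<close>

theorem proposition1:
  fixes U V :: "int \<Rightarrow> int" and n :: nat and a :: "(int \<times> int) list"
  assumes "\<And>y. U y \<in> {-1, 1}"
    and "\<And>x. V x \<in> {-1, 1}"
    and "is_cycle (corner_graph U V) n a"
  shows "is_trap (corner_graph U V) a \<and> n = 2"
proof -
  have n1: "n \<ge> 1" and len: "length a = n + 1" and closed: "a ! n = a ! 0"
    and dist: "distinct (take n a)"
    and edge: "\<And>k. k < n \<Longrightarrow> (a ! k, a ! (k + 1)) \<in> corner_graph U V"
    using assms(3) by (auto simp: is_cycle_def)
  have step0: "a ! (k + 1) = (fst (a ! k) + U (snd (a ! k)), snd (a ! k) + V (fst (a ! k)))"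
    if "k < n" for k
    using edge[OF that] by (auto simp: corner_graph_def)
  have "n \<noteq> 1"
    using step0[of 0] closed assms(1)[of "snd (a ! 0)"] by (auto simp: prod_eq_iff)
  moreover have False if "n \<ge> 3"
  proof -
    let ?h = "\<lambda>k. snd (a ! k)"
    have "Min (?h ` {..<n}) \<in> ?h ` {..<n}" using n1 by (intro Min_in) (auto simp: lessThan_empty_iff)
    then obtain m where m: "m < n" "?h m = Min (?h ` {..<n})" by auto
    \<comment> \<open>The cycle, continued periodically and started at a lowest vertex.\<close>
    define p where "p k = a ! ((m + k) mod n)" for k
    have pstep: "p (Suc k) = (fst (p k) + U (snd (p k)), snd (p k) + V (fst (p k)))" for k
      using step0[of "(m + k) mod n"] n1 closed by (auto simp: p_def mod_Suc)
    have diag: "p (Suc k) - p k \<in> diagonals" for k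
      using assms(1)[of "snd (p k)"] assms(2)[of "fst (p k)"]
      by (cases "p k") (auto simp: pstep diagonals_def)
    have periodic: "p (k + n) = p k" for k
      by (simp add: p_def flip: add.assoc)
    have inj: "inj_on p {..<n}"
    proof (rule inj_onI)
      fix k l assume kl: "k \<in> {..<n}" "l \<in> {..<n}" "p k = p l"
      then have "(m + k) mod n = (m + l) mod n"
        using dist n1 len unfolding p_def
        by (subst nth_eq_iff_index_eq[OF dist, symmetric]) auto
      moreover have "(m + j) mod n = (if m + j < n then m + j else m + j - n)" if "j < n" for j
        using m(1) that by (simp add: le_mod_geq)
      ultimately show "k = l" using kl m(1) by (simp split: if_splits)
    qed
    have lowest: "snd (p 0) \<le> snd (p k)" for k
      using m n1 by (auto simp: p_def)
    have no_reversal: "(p (Suc k) - p k) + (p (Suc (Suc k)) - p (Suc k)) \<noteq> 0" if "k < n" for k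
    proof (cases "Suc (Suc k) < n")
      case True
      then show ?thesis using inj_onD[OF inj, of k "Suc (Suc k)"] by auto
    next
      case False
      then have "p (Suc (Suc k)) = p (Suc (Suc k) - n)" using periodic[of "Suc (Suc k) - n"] by simp
      moreover have "Suc (Suc k) - n < n" "k \<noteq> Suc (Suc k) - n"
        using \<open>k < n\<close> \<open>n \<ge> 3\<close> False by arith+
      ultimately show ?thesis
        using inj_onD[OF inj, of k "Suc (Suc k) - n"] \<open>k < n\<close> by auto
    qed
    have "2 * (\<Sum>k<n. swing (p (Suc k) - p k) (p (Suc (Suc k)) - p (Suc k)))
        = (\<Sum>k<n. U (snd (p k)) * V (fst (p (Suc k))) - V (fst (p k)) * U (snd (p (Suc k))))"
      unfolding sum_distrib_left
      by (intro sum.cong refl)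
        (use swing_diagonals[OF diag diag no_reversal] in \<open>simp add: pstep\<close>)
    also have "\<dots> = 0"
      by (rule sum_turns_closed_orbit) (use assms(1,2) pstep periodic[of 0] in auto)
    finally show False
      using turning_number_closed_walk[of p n, OF diag that periodic inj lowest] by simp
  qed
  ultimately have "n = 2" using n1 by fastforce
  then show ?thesis using assms(3) by (simp add: is_trap_def)
qed

end
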